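(* Let $P(\lambda)=\sum_{i=0}^m A_i\lambda^i$ be an $n\times n$ quaternion matrix polynomial of degree $m$, with $A_0,\dots,A_m\in M_n(\mathbb{H})$, such that $A_m$ and $A_0$ are invertible. Let $r$ be the unique positive real zero of $$l(z)=\|A_m\|z^m+\cdots+\|A_1\|z-\|A_0^{-1}\|^{-1},$$ and let $R$ be the unique positive real zero of $$u(z)=\|A_m^{-1}\|^{-1}z^m-\|A_{m-1}\|z^{m-1}-\cdots-\|A_0\|.$$ Then all right eigenvalues of $P(\lambda)$ lie in the set $\{q\in\mathbb{H}: r\le |q|\le R\}$.
   Context: $\mathbb{H}$ denotes the real quaternions with modulus $|\cdot|$, and $M_n(\mathbb{H})$ is the set of $n\times n$ quaternion matrices. A quaternion $\lambda_0$ is a right eigenvalue of $P(\lambda)=\sum_{i=0}^m A_i\lambda^i$ if there is a nonzero $y\in\mathbb{H}^n$ with $\sum_{i=0}^m A_i y\lambda_0^i=0$. For $A\in M_n(\mathbb{H})$, $\|A\|=\sup_{x\in\mathbb{H}^n,\,x\neq0}\|Ax\|_2/\|x\|_2$ is the spectral norm, where $\|x\|_2=(x^*x)^{1/2}$ and $x^*$ is the conjugate transpose. *)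

theory Defs
  imports "HOL-Analysis.Analysis"
begin

section \<open>The real quaternions\<close>

text \<open>\<open>Quat a b c d\<close> stands for \<open>a + b i + c j + d k\<close>.\<close>

datatype quat = Quat (qRe: real) (qI: real) (qJ: real) (qK: real)

lemma quat_eq_iff: "x = y \<longleftrightarrow> qRe x = qRe y \<and> qI x = qI y \<and> qJ x = qJ y \<and> qK x = qK y"
  by (cases x; cases y) auto

instantiation quat :: real_vector
begin

definition "0 = Quat 0 0 0 0"
definition "x + y = Quat (qRe x + qRe y) (qI x + qI y) (qJ x + qJ y) (qK x + qK y)"
definition "- x = Quat (- qRe x) (- qI x) (- qJ x) (- qK x)"
definition "x - y = Quat (qRe x - qRe y) (qI x - qI y) (qJ x - qJ y) (qK x - qK y)"
definition "r *\<^sub>R x = Quat (r * qRe x) (r * qI x) (r * qJ x) (r * qK x)"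

instance
  by standard
    (auto simp: quat_eq_iff zero_quat_def plus_quat_def uminus_quat_def minus_quat_def
      scaleR_quat_def algebra_simps)

end

lemma quat_sel_0 [simp]: "qRe 0 = 0" "qI 0 = 0" "qJ 0 = 0" "qK 0 = 0"
  by (simp_all add: zero_quat_def)

lemma quat_sel_add [simp]:
  "qRe (x + y) = qRe x + qRe y" "qI (x + y) = qI x + qI y"
  "qJ (x + y) = qJ x + qJ y" "qK (x + y) = qK x + qK y"
  by (simp_all add: plus_quat_def)

lemma quat_sel_uminus [simp]:
  "qRe (- x) = - qRe x" "qI (- x) = - qI x" "qJ (- x) = - qJ x" "qK (- x) = - qK x"
  by (simp_all add: uminus_quat_def)

lemma quat_sel_diff [simp]:
  "qRe (x - y) = qRe x - qRe y" "qI (x - y) = qI x - qI y"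
  "qJ (x - y) = qJ x - qJ y" "qK (x - y) = qK x - qK y"
  by (simp_all add: minus_quat_def)

lemma quat_sel_scaleR [simp]:
  "qRe (r *\<^sub>R x) = r * qRe x" "qI (r *\<^sub>R x) = r * qI x"
  "qJ (r *\<^sub>R x) = r * qJ x" "qK (r *\<^sub>R x) = r * qK x"
  by (simp_all add: scaleR_quat_def)

instantiation quat :: real_algebra_1
begin

definition "1 = Quat 1 0 0 0"

definition "x * y = Quat
  (qRe x * qRe y - qI x * qI y - qJ x * qJ y - qK x * qK y)
  (qRe x * qI y + qI x * qRe y + qJ x * qK y - qK x * qJ y)
  (qRe x * qJ y - qI x * qK y + qJ x * qRe y + qK x * qI y)
  (qRe x * qK y + qI x * qJ y - qJ x * qI y + qK x * qRe y)"

instance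
  by standard (auto simp: quat_eq_iff one_quat_def times_quat_def algebra_simps)

end

lemma quat_sel_1 [simp]: "qRe 1 = 1" "qI 1 = 0" "qJ 1 = 0" "qK 1 = 0"
  by (simp_all add: one_quat_def)

lemma quat_sel_mult [simp]:
  "qRe (x * y) = qRe x * qRe y - qI x * qI y - qJ x * qJ y - qK x * qK y"
  "qI (x * y) = qRe x * qI y + qI x * qRe y + qJ x * qK y - qK x * qJ y"
  "qJ (x * y) = qRe x * qJ y - qI x * qK y + qJ x * qRe y + qK x * qI y"
  "qK (x * y) = qRe x * qK y + qI x * qJ y - qJ x * qI y + qK x * qRe y"
  by (simp_all add: times_quat_def)

definition qcnj :: "quat \<Rightarrow> quat"
  where "qcnj x = Quat (qRe x) (- qI x) (- qJ x) (- qK x)"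

lemma qcnj_sel [simp]:
  "qRe (qcnj x) = qRe x" "qI (qcnj x) = - qI x" "qJ (qcnj x) = - qJ x" "qK (qcnj x) = - qK x"
  by (simp_all add: qcnj_def)

instantiation quat :: real_normed_div_algebra
begin

definition norm_quat_def:
  "norm x = sqrt ((qRe x)\<^sup>2 + (qI x)\<^sup>2 + (qJ x)\<^sup>2 + (qK x)\<^sup>2)"
definition sgn_quat_def: "sgn (x::quat) = x /\<^sub>R norm x"
definition dist_quat_def: "dist (x::quat) y = norm (x - y)"
definition uniformity_quat_def [code del]:
  "(uniformity :: (quat \<times> quat) filter) = (INF e\<in>{0<..}. principal {(x, y). dist x y < e})"
definition open_quat_def [code del]:
  "open (U :: quat set) \<longleftrightarrow> (\<forall>x\<in>U. eventually (\<lambda>(x', y). x' = x \<longrightarrow> y \<in> U) uniformity)"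
definition inverse_quat_def: "inverse x = qcnj x /\<^sub>R (norm x)\<^sup>2"
definition divide_quat_def: "x div (y::quat) = x * (qcnj y /\<^sub>R (norm y)\<^sup>2)"

instance
proof
  fix r :: real and x y :: quat
  have norm_sq: "(norm z)\<^sup>2 = (qRe z)\<^sup>2 + (qI z)\<^sup>2 + (qJ z)\<^sup>2 + (qK z)\<^sup>2" for z :: quat
    by (simp add: norm_quat_def)
  have norm_pair: "norm z = norm ((qRe z, qI z), (qJ z, qK z))" for z :: quat
    by (simp add: norm_quat_def norm_Pair)
  show norm_eq_0: "norm z = 0 \<longleftrightarrow> z = 0" for z :: quat
    unfolding norm_pair by (simp add: norm_eq_zero zero_prod_def quat_eq_iff)
  show "norm (x + y) \<le> norm x + norm y"
    unfolding norm_pair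
    using norm_triangle_ineq[of "((qRe x, qI x), (qJ x, qK x))" "((qRe y, qI y), (qJ y, qK y))"]
    by simp
  show "norm (r *\<^sub>R x) = \<bar>r\<bar> * norm x"
    unfolding norm_pair
    using norm_scaleR[of r "((qRe x, qI x), (qJ x, qK x))"]
    by simp
  show "norm (x * y) = norm x * norm y"
    unfolding norm_quat_def real_sqrt_mult[symmetric]
    by (rule arg_cong[where f = sqrt]) (simp add: power2_eq_square algebra_simps)
  show "inverse x * x = 1" "x * inverse x = 1" if "x \<noteq> 0"
  proof -
    have "(norm x)\<^sup>2 \<noteq> 0"
      using that norm_eq_0 by simp
    moreover have "qcnj x * x = (norm x)\<^sup>2 *\<^sub>R 1" "x * qcnj x = (norm x)\<^sup>2 *\<^sub>R 1"
      by (simp_all add: quat_eq_iff norm_sq) (simp_all add: power2_eq_square algebra_simps)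
    ultimately show "inverse x * x = 1" "x * inverse x = 1"
      by (simp_all add: inverse_quat_def)
  qed
  show "inverse (0::quat) = 0"
    by (simp add: inverse_quat_def quat_eq_iff)
  show "x div y = x * inverse y"
    by (simp add: divide_quat_def inverse_quat_def)
qed (rule sgn_quat_def dist_quat_def open_quat_def uniformity_quat_def)+

end

lemma qcnj_mult_self: "qcnj x * x = of_real ((norm x)\<^sup>2)"
  by (simp add: quat_eq_iff of_real_def norm_quat_def) (simp add: power2_eq_square algebra_simps)

section \<open>Quaternion vectors, matrices and matrix polynomials\<close>

text \<open>
  The library norm on \<^typ>\<open>quat^'n\<close> is the norm \<open>(x\<^sup>* x)\<^sup>1\<^sup>/\<^sup>2\<close>.
\<close>

lemma sum_qcnj_mult_self:
  fixes x :: "quat^'n"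
  shows "(\<Sum>i\<in>UNIV. qcnj (x $ i) * x $ i) = of_real ((norm x)\<^sup>2)"
proof -
  have "(norm x)\<^sup>2 = (\<Sum>i\<in>UNIV. (norm (x $ i))\<^sup>2)"
    by (simp add: norm_vec_def L2_set_def sum_nonneg)
  then show ?thesis
    by (simp add: qcnj_mult_self)
qed

definition spectral_norm :: "quat^'n^'m \<Rightarrow> real"
  where "spectral_norm A = (SUP x\<in>{x. x \<noteq> 0}. norm (A *v x) / norm x)"

definition rscale :: "quat^'n \<Rightarrow> quat \<Rightarrow> quat^'n"
  where "rscale y q = (\<chi> k. y $ k * q)"

text \<open>
  A matrix polynomial \<open>\<Sum>i\<le>m. A\<^sub>i \<lambda>\<^sup>i\<close> is given by its coefficients \<^term>\<open>A :: nat \<Rightarrow> quat^'n^'n\<close>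
  and its degree bound \<^term>\<open>m::nat\<close>; the values \<open>A i\<close> with \<open>i > m\<close> are irrelevant.
\<close>

definition right_eigenvalue :: "(nat \<Rightarrow> quat^'n^'n) \<Rightarrow> nat \<Rightarrow> quat \<Rightarrow> bool"
  where "right_eigenvalue A m \<mu> \<longleftrightarrow> (\<exists>y. y \<noteq> 0 \<and> (\<Sum>i\<le>m. rscale (A i *v y) (\<mu> ^ i)) = 0)"

definition lower_poly :: "(nat \<Rightarrow> quat^'n^'n) \<Rightarrow> nat \<Rightarrow> real \<Rightarrow> real"
  where "lower_poly A m z =
    (\<Sum>i=1..m. spectral_norm (A i) * z ^ i) - inverse (spectral_norm (matrix_inv (A 0)))"

definition upper_poly :: "(nat \<Rightarrow> quat^'n^'n) \<Rightarrow> nat \<Rightarrow> real \<Rightarrow> real"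
  where "upper_poly A m z =
    inverse (spectral_norm (matrix_inv (A m))) * z ^ m - (\<Sum>i<m. spectral_norm (A i) * z ^ i)"

definition positive_zero :: "(real \<Rightarrow> real) \<Rightarrow> real \<Rightarrow> bool"
  where "positive_zero f z \<longleftrightarrow> 0 < z \<and> f z = 0"

end

theory Submission
  imports Defs
begin

text \<open>
  This is Cauchy's bound for the zeros of a polynomial, with spectral norms in place of absolute
  values. Let \<open>\<Sum>i\<le>m. A\<^sub>i y q\<^sup>i = 0\<close> with \<open>y \<noteq> 0\<close>. The norm is multiplicative for the right scaling by
  \<open>q\<close>, so isolating the \<open>k\<close>-th term and applying the triangle inequality
  (lemma \<open>norm_term_le_other_terms\<close>) together with \<open>\<parallel>A\<^sub>k\<inverse>\<parallel>\<inverse> \<parallel>y\<parallel> \<le> \<parallel>A\<^sub>k y\<parallel>\<close> gives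
  \<open>\<parallel>A\<^sub>k\<inverse>\<parallel>\<inverse> |q|\<^sup>k \<le> \<Sum>i\<noteq>k. \<parallel>A\<^sub>i\<parallel> |q|\<^sup>i\<close>. For \<open>k = 0\<close> this says that the lower polynomial is nonnegative at
  \<open>|q|\<close>, and for \<open>k = m\<close> that the upper polynomial is nonpositive at \<open>|q|\<close>.

  The rest concerns a single real variable. A polynomial \<open>\<Sum>i=1..m. b\<^sub>i z\<^sup>i - c\<close> with \<open>b\<^sub>i \<ge> 0\<close> and
  \<open>b\<^sub>m, c > 0\<close> increases strictly on the nonnegative reals, from \<open>-c\<close> to infinity, so that it has
  exactly one positive zero. The lower polynomial has this form, and the substitution \<open>z \<mapsto> 1/z\<close>
  brings the upper polynomial to this form up to a negative factor
  (lemma \<open>reversed_polynomial\<close>).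
\<close>

section \<open>The spectral norm of a quaternion matrix\<close>

text \<open>
  The bound is the sum of the moduli of all entries. Without it the supremum that defines the
  spectral norm would be an unspecified real number.
\<close>

lemma bdd_above_spectral_norm:
  fixes A :: "quat^'n^'m"
  shows "bdd_above ((\<lambda>x. norm (A *v x) / norm x) ` {x. x \<noteq> 0})"
proof (rule bdd_aboveI2)
  fix x :: "quat^'n"
  assume "x \<in> {x. x \<noteq> 0}"
  then have "norm x > 0" by simp
  have "norm ((A *v x) $ i) \<le> (\<Sum>j\<in>UNIV. norm (A $ i $ j)) * norm x" for i
  proof -
    have "norm ((A *v x) $ i) \<le> (\<Sum>j\<in>UNIV. norm (A $ i $ j * x $ j))"
      by (simp add: matrix_vector_mult_def norm_sum)
    also have "\<dots> \<le> (\<Sum>j\<in>UNIV. norm (A $ i $ j) * norm x)"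
      by (intro sum_mono) (simp add: norm_mult mult_left_mono Finite_Cartesian_Product.norm_nth_le)
    finally show ?thesis by (simp add: sum_distrib_right)
  qed
  then have "(\<Sum>i\<in>UNIV. norm ((A *v x) $ i)) \<le> (\<Sum>i\<in>UNIV. (\<Sum>j\<in>UNIV. norm (A $ i $ j)) * norm x)"
    by (intro sum_mono) simp
  moreover have "norm (A *v x) \<le> (\<Sum>i\<in>UNIV. norm ((A *v x) $ i))"
    by (simp add: norm_vec_def L2_set_le_sum)
  ultimately have "norm (A *v x) \<le> (\<Sum>i\<in>UNIV. \<Sum>j\<in>UNIV. norm (A $ i $ j)) * norm x"
    by (simp add: sum_distrib_right)
  then show "norm (A *v x) / norm x \<le> (\<Sum>i\<in>UNIV. \<Sum>j\<in>UNIV. norm (A $ i $ j))"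
    using \<open>norm x > 0\<close> by (simp add: pos_divide_le_eq)
qed

lemma norm_matrix_vector_le_spectral_norm:
  fixes A :: "quat^'n^'m"
  shows "norm (A *v x) \<le> spectral_norm A * norm x"
proof (cases "x = 0")
  case False
  then have "norm (A *v x) / norm x \<le> spectral_norm A"
    unfolding spectral_norm_def by (intro cSUP_upper bdd_above_spectral_norm) simp
  then show ?thesis
    using False by (simp add: pos_divide_le_eq)
qed simp

lemma spectral_norm_nonneg:
  fixes A :: "quat^'n^'m"
  shows "spectral_norm A \<ge> 0"
proof -
  have "0 \<le> spectral_norm A * norm (1 :: quat^'n)"
    using norm_matrix_vector_le_spectral_norm[of A 1] norm_ge_zero[of "A *v 1"] by linarith
  moreover have "norm (1 :: quat^'n) > 0"
    by (simp add: vec_eq_iff)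
  ultimately show ?thesis
    by (simp add: zero_le_mult_iff)
qed

lemma matrix_inv_vector_cancel:
  fixes A :: "quat^'n^'n"
  assumes "invertible A"
  shows "matrix_inv A *v (A *v x) = x"
proof -
  have "matrix_inv A ** A = mat 1"
    using someI_ex[OF assms[unfolded invertible_def]] by (simp add: matrix_inv_def)
  then show ?thesis
    by (simp add: matrix_vector_mul_assoc)
qed

lemma spectral_norm_pos:
  fixes A :: "quat^'n^'n"
  assumes "invertible A"
  shows "spectral_norm A > 0" "spectral_norm (matrix_inv A) > 0"
proof -
  \<comment> \<open>The all-ones vector serves as a nonzero test vector.\<close>
  let ?e = "1 :: quat^'n"
  have e: "?e = matrix_inv A *v (A *v ?e)"
    using matrix_inv_vector_cancel[OF assms] by simp
  have "?e \<noteq> 0"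
    by (simp add: vec_eq_iff)
  have "A *v ?e \<noteq> 0"
  proof
    assume "A *v ?e = 0"
    with e \<open>?e \<noteq> 0\<close> show False by simp
  qed
  have "spectral_norm A \<noteq> 0"
    using norm_matrix_vector_le_spectral_norm[of A ?e] \<open>A *v ?e \<noteq> 0\<close> by auto
  then show "spectral_norm A > 0"
    using spectral_norm_nonneg[of A] by simp
  have "spectral_norm (matrix_inv A) \<noteq> 0"
    using norm_matrix_vector_le_spectral_norm[of "matrix_inv A" "A *v ?e"] e \<open>?e \<noteq> 0\<close> by auto
  then show "spectral_norm (matrix_inv A) > 0"
    using spectral_norm_nonneg[of "matrix_inv A"] by simp
qed

lemma norm_matrix_vector_ge:
  fixes A :: "quat^'n^'n"
  assumes "invertible A"
  shows "inverse (spectral_norm (matrix_inv A)) * norm x \<le> norm (A *v x)"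
proof -
  have "norm x \<le> spectral_norm (matrix_inv A) * norm (A *v x)"
    using norm_matrix_vector_le_spectral_norm[of "matrix_inv A" "A *v x"]
    by (simp only: matrix_inv_vector_cancel[OF assms])
  then have "norm x / spectral_norm (matrix_inv A) \<le> norm (A *v x)"
    using spectral_norm_pos(2)[OF assms] by (simp only: pos_divide_le_eq mult.commute)
  then show ?thesis
    by (simp only: divide_inverse mult.commute)
qed

section \<open>Norm estimates for right eigenvalues\<close>

lemma norm_rscale: "norm (rscale y q) = norm y * norm q"
proof -
  have "(\<lambda>i. norm (rscale y q $ i)) = (\<lambda>i. norm (y $ i) * norm q)"
    by (simp add: rscale_def norm_mult)
  then show ?thesis
    by (simp add: norm_vec_def L2_set_left_distrib)
qed

text \<open>Each term with an invertible coefficient must be balanced by the remaining ones.\<close>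

lemma norm_term_le_other_terms:
  fixes A :: "nat \<Rightarrow> quat^'n^'n"
  assumes "right_eigenvalue A m q" and "k \<le> m" and "invertible (A k)"
  shows "inverse (spectral_norm (matrix_inv (A k))) * norm q ^ k
    \<le> (\<Sum>i\<in>{..m} - {k}. spectral_norm (A i) * norm q ^ i)"
proof -
  obtain y where "y \<noteq> 0" and sum0: "(\<Sum>i\<le>m. rscale (A i *v y) (q ^ i)) = 0"
    using assms(1) unfolding right_eigenvalue_def by blast
  have "rscale (A k *v y) (q ^ k) = - (\<Sum>i\<in>{..m} - {k}. rscale (A i *v y) (q ^ i))"
    using sum0 assms(2) by (simp add: sum.remove[of _ k] eq_neg_iff_add_eq_0)
  then have "norm (rscale (A k *v y) (q ^ k)) = norm (\<Sum>i\<in>{..m} - {k}. rscale (A i *v y) (q ^ i))"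
    by (simp only: norm_minus_cancel)
  then have "norm (A k *v y) * norm q ^ k = norm (\<Sum>i\<in>{..m} - {k}. rscale (A i *v y) (q ^ i))"
    by (simp only: norm_rscale norm_power)
  also have "\<dots> \<le> (\<Sum>i\<in>{..m} - {k}. norm (A i *v y) * norm q ^ i)"
    using norm_sum[of "\<lambda>i. rscale (A i *v y) (q ^ i)" "{..m} - {k}"]
    by (simp add: norm_rscale norm_power)
  also have "\<dots> \<le> (\<Sum>i\<in>{..m} - {k}. (spectral_norm (A i) * norm y) * norm q ^ i)"
    by (intro sum_mono mult_right_mono norm_matrix_vector_le_spectral_norm) simp
  also have "\<dots> = norm y * (\<Sum>i\<in>{..m} - {k}. spectral_norm (A i) * norm q ^ i)"
    by (simp add: sum_distrib_left mult_ac)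
  finally have "norm (A k *v y) * norm q ^ k
      \<le> norm y * (\<Sum>i\<in>{..m} - {k}. spectral_norm (A i) * norm q ^ i)" .
  moreover have "(inverse (spectral_norm (matrix_inv (A k))) * norm y) * norm q ^ k
      \<le> norm (A k *v y) * norm q ^ k"
    by (intro mult_right_mono norm_matrix_vector_ge assms(3)) simp
  ultimately have "norm y * (inverse (spectral_norm (matrix_inv (A k))) * norm q ^ k)
      \<le> norm y * (\<Sum>i\<in>{..m} - {k}. spectral_norm (A i) * norm q ^ i)"
    by (simp add: mult_ac)
  then show ?thesis
    using \<open>y \<noteq> 0\<close> by (simp add: mult_le_cancel_left_pos)
qed

section \<open>Positive zeros of real polynomials with one sign change\<close>

lemma sum_nonneg_coeffs_strict_mono:
  fixes b :: "nat \<Rightarrow> real"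
  assumes "m \<ge> 1" and "\<And>i. b i \<ge> 0" and "b m > 0" and "0 \<le> x" and "x < y"
  shows "(\<Sum>i=1..m. b i * x ^ i) < (\<Sum>i=1..m. b i * y ^ i)"
proof (rule sum_strict_mono_ex1)
  show "\<forall>i\<in>{1..m}. b i * x ^ i \<le> b i * y ^ i"
    using assms by (auto intro!: mult_left_mono power_mono)
  show "\<exists>i\<in>{1..m}. b i * x ^ i < b i * y ^ i"
    using assms by (intro bexI[of _ m] mult_strict_left_mono power_strict_mono) auto
qed simp

lemma ex1_positive_zero_nonneg_coeffs:
  fixes b :: "nat \<Rightarrow> real"
  assumes "m \<ge> 1" and "\<And>i. b i \<ge> 0" and "b m > 0" and "c > 0"
  shows "\<exists>!r. positive_zero (\<lambda>z. (\<Sum>i=1..m. b i * z ^ i) - c) r"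
proof (rule ex_ex1I)
  let ?f = "\<lambda>z. (\<Sum>i=1..m. b i * z ^ i) - c"
  \<comment> \<open>The term of degree \<open>m\<close> alone reaches \<open>c\<close> at \<open>Z\<close>, since \<open>Z\<^sup>m \<ge> Z\<close> for \<open>Z \<ge> 1\<close>.\<close>
  define Z where "Z = max 1 (c / b m)"
  have "c \<le> b m * Z"
    using assms(3) by (simp add: Z_def field_simps max_def)
  also have "\<dots> \<le> b m * Z ^ m"
    using assms(1,3) power_increasing[of 1 m Z] by (simp add: Z_def)
  also have "\<dots> \<le> (\<Sum>i=1..m. b i * Z ^ i)"
    using assms(1,2) by (intro member_le_sum) (auto simp: Z_def)
  finally have "0 \<le> ?f Z" by simp
  moreover have f0: "?f 0 = - c"
    by simp
  moreover have "0 \<le> Z"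
    by (simp add: Z_def)
  moreover have "continuous_on {0..Z} ?f"
    by (intro continuous_intros)
  ultimately obtain r where r: "0 \<le> r" "?f r = 0"
    using IVT'[of ?f 0 0 Z] assms(4) by auto
  then have "r \<noteq> 0"
    using f0 assms(4) by auto
  with r show "\<exists>r. positive_zero ?f r"
    by (auto simp: positive_zero_def intro!: exI[of _ r])
next
  fix r s
  assume "positive_zero (\<lambda>z. (\<Sum>i=1..m. b i * z ^ i) - c) r"
    and "positive_zero (\<lambda>z. (\<Sum>i=1..m. b i * z ^ i) - c) s"
  then show "r = s"
    using sum_nonneg_coeffs_strict_mono[of m b r s, OF assms(1-3)]
      sum_nonneg_coeffs_strict_mono[of m b s r, OF assms(1-3)]
    by (cases r s rule: linorder_cases) (auto simp: positive_zero_def)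
qed

lemma reversed_polynomial:
  fixes z :: real
  assumes "z \<noteq> 0"
  shows "c * z ^ m - (\<Sum>i<m. a i * z ^ i) = - (z ^ m * ((\<Sum>j=1..m. a (m - j) * inverse z ^ j) - c))"
proof -
  have "z ^ m * (\<Sum>j=1..m. a (m - j) * inverse z ^ j) = (\<Sum>j=1..m. a (m - j) * z ^ (m - j))"
    unfolding sum_distrib_left
    using assms by (intro sum.cong) (auto simp: power_diff field_simps)
  also have "\<dots> = (\<Sum>i<m. a i * z ^ i)"
    by (rule sum.reindex_bij_witness[of _ "\<lambda>i. m - i" "\<lambda>j. m - j"]) auto
  finally show ?thesis
    by (simp add: algebra_simps)
qed

lemma ex1_positive_zero_inverse:
  assumes "\<exists>!r. positive_zero f r" and "\<And>z. positive_zero g z \<longleftrightarrow> positive_zero f (inverse z)"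
  shows "\<exists>!r. positive_zero g r"
  using assms by (metis inverse_inverse_eq)

section \<open>The annulus containing the right eigenvalues\<close>

theorem theorem4p19:
  fixes A :: "nat \<Rightarrow> quat^'n^'n" and m :: nat
  assumes "m \<ge> 1"
    and "invertible (A m)"
    and "invertible (A 0)"
  shows "(\<exists>!r. positive_zero (lower_poly A m) r) \<and>
    (\<exists>!R. positive_zero (upper_poly A m) R) \<and>
    (\<forall>r R. positive_zero (lower_poly A m) r \<longrightarrow> positive_zero (upper_poly A m) R \<longrightarrow>
      {q. right_eigenvalue A m q} \<subseteq> {q. r \<le> norm q \<and> norm q \<le> R})"
proof (intro conjI allI impI subsetI CollectI)
  let ?a = "\<lambda>i. spectral_norm (A i)"
  let ?b = "\<lambda>j. spectral_norm (A (m - j))"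
  define c where "c = inverse (spectral_norm (matrix_inv (A m)))"
  \<comment> \<open>The reversed coefficients are chosen so that the upper polynomial is \<open>- z\<^sup>m g(1/z)\<close>.\<close>
  define g where "g = (\<lambda>z. (\<Sum>j=1..m. ?b j * z ^ j) - c)"
  have b: "\<And>j. ?b j \<ge> 0" "?b m > 0"
    using spectral_norm_nonneg spectral_norm_pos(1)[OF assms(3)] by auto
  have a: "\<And>i. ?a i \<ge> 0" "?a m > 0"
    using spectral_norm_nonneg spectral_norm_pos(1)[OF assms(2)] by auto
  have upper: "upper_poly A m z = - (z ^ m * g (inverse z))" if "z \<noteq> 0" for z
    unfolding upper_poly_def g_def c_def using reversed_polynomial[OF that] .
  have zero_iff: "positive_zero (upper_poly A m) z \<longleftrightarrow> positive_zero g (inverse z)" for z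
    using upper[of z] by (auto simp: positive_zero_def)
  have "c > 0"
    using spectral_norm_pos(2)[OF assms(2)] by (simp add: c_def)
  have lower: "lower_poly A m =
      (\<lambda>z. (\<Sum>i=1..m. ?a i * z ^ i) - inverse (spectral_norm (matrix_inv (A 0))))"
    by (auto simp: lower_poly_def)
  show "\<exists>!r. positive_zero (lower_poly A m) r"
    unfolding lower using spectral_norm_pos(2)[OF assms(3)]
    by (intro ex1_positive_zero_nonneg_coeffs[of m ?a, OF assms(1) a]) simp
  show "\<exists>!R. positive_zero (upper_poly A m) R"
  proof (rule ex1_positive_zero_inverse)
    show "\<exists>!r. positive_zero g r"
      unfolding g_def using assms(1) b \<open>c > 0\<close> by (rule ex1_positive_zero_nonneg_coeffs)
  qed (rule zero_iff)
  fix r R q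
  assume r: "positive_zero (lower_poly A m) r" and R: "positive_zero (upper_poly A m) R"
    and "q \<in> {q. right_eigenvalue A m q}"
  then have q: "right_eigenvalue A m q" by simp
  have "{..m} - {0} = {1..m}" "{..m} - {m} = {..<m}"
    by auto
  then have l: "lower_poly A m (norm q) \<ge> 0" and u: "upper_poly A m (norm q) \<le> 0"
    using norm_term_le_other_terms[OF q _ assms(3)] norm_term_le_other_terms[OF q _ assms(2)]
    by (auto simp: lower_poly_def upper_poly_def)
  show "r \<le> norm q"
  proof (rule ccontr)
    assume "\<not> r \<le> norm q"
    then have "lower_poly A m (norm q) < lower_poly A m r"
      unfolding lower_poly_def using sum_nonneg_coeffs_strict_mono[of m ?a "norm q" r, OF assms(1) a] by simp
    with l r show False
      by (simp add: positive_zero_def)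
  qed
  show "norm q \<le> R"
  proof (rule ccontr)
    assume "\<not> norm q \<le> R"
    moreover have "R > 0"
      using R by (simp add: positive_zero_def)
    ultimately have "norm q > 0" "inverse (norm q) < inverse R"
      by (auto simp: less_imp_inverse_less)
    then have "g (inverse (norm q)) < g (inverse R)"
      unfolding g_def using sum_nonneg_coeffs_strict_mono[of m ?b, OF assms(1) b] by simp
    also have "g (inverse R) = 0"
      using R zero_iff by (simp add: positive_zero_def)
    finally have "norm q ^ m * g (inverse (norm q)) < 0"
      using \<open>norm q > 0\<close> by (simp add: mult_pos_neg)
    with u upper[of "norm q"] \<open>norm q > 0\<close> show False
      by simp
  qed
qed

end
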